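(* Let $\Gamma$ be an irreducible subgroup of $\mathrm{SU}(2,1)$. Then $\Gamma$ contains a loxodromic element.
   Context: Let $V=\mathbb{C}^{3}$ with the Hermitian form $\langle z,w\rangle=z_1\bar w_3+z_2\bar w_2+z_3\bar w_1$ of signature $(2,1)$. $\mathrm{SU}(2,1)$ is the group of $3\times 3$ complex matrices of determinant $1$ preserving this form. The complex hyperbolic plane $\mathbf{H}^2_{\mathbb{C}}\subset\mathbb{P}(V)$ is the set of projective classes of vectors $v$ with $\langle v,v\rangle<0$, and its boundary $\partial\mathbf{H}^2_{\mathbb{C}}$ is the set of classes of nonzero $v$ with $\langle v,v\rangle=0$. An element of $\mathrm{SU}(2,1)$ is loxodromic if its action on $\mathbf{H}^2_{\mathbb{C}}\cup\partial\mathbf{H}^2_{\mathbb{C}}$ has no fixed point in $\mathbf{H}^2_{\mathbb{C}}$ and exactly two fixed points on $\partial\mathbf{H}^2_{\mathbb{C}}$. A subgroup $\Gamma$ of $\mathrm{SU}(2,1)$ is reducible if it has an invariant proper nonzero $\mathbb{C}$-subspace of $V$, and irreducible otherwise; $\Gamma$ is not assumed to be discrete. *)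

theory Defs
  imports "HOL-Analysis.Analysis" "HOL-Algebra.Group"
begin

definition herm :: "complex^3 \<Rightarrow> complex^3 \<Rightarrow> complex"
  where "herm z w = z$1 * cnj (w$3) + z$2 * cnj (w$2) + z$3 * cnj (w$1)"

lemma Im_herm_self: "Im (herm z z) = 0"
  by (simp add: herm_def)

definition SU21 :: "(complex^3^3) monoid"
  where "SU21 = \<lparr>carrier = {A. det A = 1 \<and> (\<forall>z w. herm (A *v z) (A *v w) = herm z w)},
                 mult = (\<lambda>A B. A ** B), one = mat 1\<rparr>"

lemma group_SU21: "group SU21"
proof (rule groupI)
  fix A assume "A \<in> carrier SU21"
  then have d: "det A = 1" and h: "\<And>z w. herm (A *v z) (A *v w) = herm z w"
    by (auto simp: SU21_def)
  have "invertible A" using d by (simp add: invertible_det_nz)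
  then obtain B where AB: "A ** B = mat 1" and BA: "B ** A = mat 1"
    by (auto simp: invertible_def)
  have "det B = 1" using arg_cong[OF AB, of det] d by (simp add: det_mul)
  moreover have "herm (B *v z) (B *v w) = herm z w" for z w
    using h[of "B *v z" "B *v w"] by (simp add: matrix_vector_mul_assoc AB)
  ultimately show "\<exists>B\<in>carrier SU21. B \<otimes>\<^bsub>SU21\<^esub> A = \<one>\<^bsub>SU21\<^esub>"
    using BA by (auto simp: SU21_def)
qed (auto simp: SU21_def det_mul matrix_mul_assoc simp flip: matrix_vector_mul_assoc)

text \<open>Projective classes are represented by complex lines \<open>vec.span {v}\<close> with \<open>v \<noteq> 0\<close>,
  where \<open>vec.span\<close> and \<open>vec.subspace\<close> refer to complex scalar multiplication (unlike the
  unqualified \<open>span\<close> and \<open>subspace\<close>, which are real-linear). A matrix acts on a class by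
  taking the image of the line.\<close>

definition HC2 :: "(complex^3) set set"
  where "HC2 = {vec.span {v} |v. Re (herm v v) < 0}"

definition boundary_HC2 :: "(complex^3) set set"
  where "boundary_HC2 = {vec.span {v} |v. v \<noteq> 0 \<and> herm v v = 0}"

definition proj_act :: "complex^3^3 \<Rightarrow> (complex^3) set \<Rightarrow> (complex^3) set"
  where "proj_act A p = (\<lambda>v. A *v v) ` p"

lemma proj_act_span: "proj_act A (vec.span {v}) = vec.span {A *v v}"
  by (auto simp: proj_act_def vec.span_singleton image_iff vector_scalar_commute)

lemma proj_act_HC2: "A \<in> carrier SU21 \<Longrightarrow> p \<in> HC2 \<Longrightarrow> proj_act A p \<in> HC2"
  by (force simp: HC2_def SU21_def proj_act_span)

lemma proj_act_boundary_HC2: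
  assumes "A \<in> carrier SU21" "p \<in> boundary_HC2"
  shows "proj_act A p \<in> boundary_HC2"
proof -
  from assms(2) obtain v where v: "p = vec.span {v}" "v \<noteq> 0" "herm v v = 0"
    by (auto simp: boundary_HC2_def)
  have "det A = 1" using assms(1) by (simp add: SU21_def)
  then have "invertible A" by (simp add: invertible_det_nz)
  then have "A *v v \<noteq> 0"
    using v(2) by (metis invertible_def matrix_left_invertible_ker)
  moreover have "herm (A *v v) (A *v v) = 0"
    using assms(1) v(3) by (simp add: SU21_def)
  ultimately show ?thesis
    by (auto simp: boundary_HC2_def v(1) proj_act_span)
qed

definition loxodromic :: "complex^3^3 \<Rightarrow> bool"
  where "loxodromic A \<longleftrightarrow>
    A \<in> carrier SU21 \<and>
    (\<forall>p\<in>HC2. proj_act A p \<noteq> p) \<and>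
    card {p \<in> boundary_HC2. proj_act A p = p} = 2"

definition reducible_on_V :: "(complex^3^3) set \<Rightarrow> bool"
  where "reducible_on_V \<Gamma> \<longleftrightarrow>
    (\<exists>W. vec.subspace W \<and> W \<noteq> {0} \<and> W \<noteq> UNIV \<and> (\<forall>A\<in>\<Gamma>. \<forall>v\<in>W. A *v v \<in> W))"

abbreviation irreducible_on_V :: "(complex^3^3) set \<Rightarrow> bool"
  where "irreducible_on_V \<Gamma> \<equiv> \<not> reducible_on_V \<Gamma>"

end

theory Submission
  imports Defs "HOL-Computational_Algebra.Fundamental_Theorem_Algebra"
begin

text \<open>
  An element whose trace has modulus above 3 has an eigenvalue \<open>x\<close> with \<open>\<bar>x\<bar> > 1\<close>, hence also the
  eigenvalue \<open>1 / cnj x\<close>; the two eigenvectors are null and give the only fixed points, so the element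
  is loxodromic. Suppose therefore that all traces in \<open>\<Gamma>\<close> are bounded by 3.

  If \<open>\<Gamma>\<close> were unbounded, a limit \<open>T\<close> of normalized elements would have totally isotropic image, hence
  rank one, and \<open>trace (T B) = 0\<close> for all \<open>B\<close> in \<open>\<Gamma>\<close>. For a rank one \<open>T\<close> this means that \<open>T B\<close> kills the
  image of \<open>T\<close>, so that \<open>{w. \<forall>B\<in>\<Gamma>. T B w = 0}\<close> is a proper nonzero invariant subspace.

  If \<open>\<Gamma>\<close> is bounded, its conjugation action has a fixed point \<open>Y\<close> in the invariant closed convex set of
  matrices with \<open>trace Y = -1\<close> and \<open>\<langle>Y v, v\<rangle> \<ge> 0\<close> for all \<open>v\<close>. This \<open>Y\<close> commutes with \<open>\<Gamma>\<close>, so by Schur's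
  lemma \<open>Y = -1/3\<close>, contradicting \<open>\<langle>Y v, v\<rangle> \<ge> 0\<close> at a positive vector \<open>v\<close>.
\<close>

section \<open>Fixed points of uniformly bounded linear groups\<close>

lemma norm_add_sq_plus_norm_diff_sq:
  fixes x y :: "'a::real_inner"
  shows "(norm (x + y))\<^sup>2 + (norm (x - y))\<^sup>2 = 2 * (norm x)\<^sup>2 + 2 * (norm y)\<^sup>2"
  by (simp add: power2_norm_eq_inner inner_add_left inner_add_right inner_diff_left inner_diff_right)

text \<open>The supremum \<open>f\<close> of the norm over the orbit of a point is a
  \<open>G\<close>-invariant norm. It attains its minimum on \<open>K\<close> at exactly one point,
  and \<open>G\<close> must fix that point.\<close>

lemma bounded_linear_group_fixed_point:
  fixes G :: "('a::euclidean_space \<Rightarrow> 'a) set"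
  assumes linear: "\<And>g. g \<in> G \<Longrightarrow> linear g"
    and id: "(\<lambda>x. x) \<in> G"
    and comp: "\<And>g h. g \<in> G \<Longrightarrow> h \<in> G \<Longrightarrow> (\<lambda>x. g (h x)) \<in> G"
    and inverse: "\<And>g. g \<in> G \<Longrightarrow> \<exists>h\<in>G. \<forall>x. h (g x) = x"
    and bound: "\<And>g x. g \<in> G \<Longrightarrow> norm (g x) \<le> C * norm x"
    and K: "closed K" "convex K" "K \<noteq> {}"
    and invariant: "\<And>g x. g \<in> G \<Longrightarrow> x \<in> K \<Longrightarrow> g x \<in> K"
  shows "\<exists>x\<in>K. \<forall>g\<in>G. g x = x"
proof -
  \<comment> \<open>Nothing makes \<open>C\<close> positive; \<open>D\<close> serves as a Lipschitz
    constant and as a divisor.\<close>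
  define D where "D = max C 1"
  have D: "D > 0" "D \<ge> 1" by (auto simp: D_def)
  have boundD: "norm (g x) \<le> D * norm x" if "g \<in> G" for g x
    using bound[OF that, of x] mult_right_mono[of C D "norm x"] by (simp add: D_def)
  define f where "f x = (SUP g\<in>G. norm (g x))" for x
  have f_ge: "norm (g x) \<le> f x" if "g \<in> G" for g x
    unfolding f_def using boundD that by (intro cSUP_upper bdd_aboveI2) auto
  have f_le: "f x \<le> B" if "\<And>g. g \<in> G \<Longrightarrow> norm (g x) \<le> B" for x B
    unfolding f_def using that id by (intro cSUP_least) auto
  have f_norm: "norm x \<le> f x" for x
    using f_ge[OF id] .
  have f_diff: "f x \<le> f y + D * norm (x - y)" for x y
  proof (rule f_le)
    fix g assume g: "g \<in> G"
    have "norm (g x) \<le> norm (g y) + norm (g (x - y))"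
      by (simp add: linear_diff[OF linear[OF g]] norm_triangle_sub)
    then show "norm (g x) \<le> f y + D * norm (x - y)"
      using f_ge[OF g, of y] boundD[OF g, of "x - y"] by linarith
  qed
  have "D-lipschitz_on UNIV f"
  proof (rule lipschitz_onI)
    fix x y
    show "dist (f x) (f y) \<le> D * dist x y"
      using f_diff[of x y] f_diff[of y x] by (simp add: dist_norm norm_minus_commute abs_le_iff)
  qed (use D in simp)
  then have cont: "continuous_on S f" for S
    by (meson continuous_on_subset lipschitz_on_continuous_on subset_UNIV)
  obtain x0 where x0: "x0 \<in> K" using K by auto
  \<comment> \<open>Since \<open>norm y \<le> f y\<close>, points of \<open>K\<close> outside this
    ball cannot beat \<open>x0\<close>, so a minimizer on the compact piece is one on all of
    \<open>K\<close>.\<close>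
  have "compact (K \<inter> cball 0 (f x0))"
    using K by (simp add: closed_Int_compact)
  moreover have "x0 \<in> K \<inter> cball 0 (f x0)"
    using x0 f_norm by simp
  ultimately obtain m where m: "m \<in> K" "\<And>y. y \<in> K \<inter> cball 0 (f x0) \<Longrightarrow> f m \<le> f y"
    using continuous_attains_inf[OF _ _ cont] by (metis IntD1 empty_iff)
  have min: "f m \<le> f y" if "y \<in> K" for y
  proof (cases "norm y \<le> f x0")
    case True
    then show ?thesis using m(2) that by simp
  next
    case False
    then show ?thesis
      using m(2)[of x0] x0 f_norm[of x0] f_norm[of y] by simp
  qed
  \<comment> \<open>The parallelogram identity makes \<open>f\<close> strictly convex along each segment,
    uniformly over \<open>G\<close>, so its minimizer is unique.\<close>
  have unique: "y = m" if y: "y \<in> K" "f y \<le> f m" for y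
  proof (rule ccontr)
    assume "y \<noteq> m"
    \<comment> \<open>The inverse of \<open>g\<close> obeys the same bound, so
      \<open>norm (g (m - y))\<close> is at least \<open>norm (m - y) / D\<close> for every
      \<open>g\<close>; a quarter of the square is the loss at the midpoint in the parallelogram
      identity.\<close>
    define \<delta> where "\<delta> = (norm (m - y) / D)\<^sup>2 / 4"
    have "\<delta> > 0" using D \<open>y \<noteq> m\<close> by (simp add: \<delta>_def)
    define z where "z = (1/2) *\<^sub>R (m + y)"
    have "z \<in> K"
      using convexD[OF K(2) m(1) y(1), of "1/2" "1/2"] by (simp add: z_def scaleR_add_right)
    have sq: "(norm (g z))\<^sup>2 \<le> (f m)\<^sup>2 - \<delta>" if g: "g \<in> G" for g
    proof -
      interpret linear g by (rule linear[OF g])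
      have "norm (g z) = norm (g m + g y) / 2"
        by (simp add: z_def scaleR add flip: scaleR_add_right)
      then have gz: "(norm (g z))\<^sup>2 = (norm (g m + g y))\<^sup>2 / 4"
        by (simp only: power_divide) simp
      have par: "(norm (g z))\<^sup>2 = ((norm (g m))\<^sup>2 + (norm (g y))\<^sup>2) / 2 - (norm (g (m - y)))\<^sup>2 / 4"
        using norm_add_sq_plus_norm_diff_sq[of "g m" "g y"]
        unfolding gz diff by (simp add: field_simps)
      obtain h where h: "h \<in> G" "\<And>x. h (g x) = x" using inverse[OF g] by blast
      have "norm (m - y) \<le> D * norm (g (m - y))"
        using boundD[OF h(1), of "g (m - y)"] h(2) by simp
      then have "norm (m - y) / D \<le> norm (g (m - y))"
        using D by (simp add: field_simps)
      then have "(norm (m - y) / D)\<^sup>2 \<le> (norm (g (m - y)))\<^sup>2"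
        using D by (intro power_mono) auto
      moreover have "(norm (g m))\<^sup>2 \<le> (f m)\<^sup>2" "(norm (g y))\<^sup>2 \<le> (f m)\<^sup>2"
        using f_ge[OF g, of m] f_ge[OF g, of y] y(2) by (auto intro!: power_mono)
      ultimately show ?thesis unfolding par \<delta>_def by argo
    qed
    have "f z \<le> sqrt ((f m)\<^sup>2 - \<delta>)"
      using sq by (intro f_le real_le_rsqrt)
    then have "f m \<le> sqrt ((f m)\<^sup>2 - \<delta>)"
      using min[OF \<open>z \<in> K\<close>] by linarith
    moreover have "f m \<ge> 0" "(f m)\<^sup>2 - \<delta> \<ge> 0"
      using f_norm[of m] norm_ge_zero[of m] sq[OF id] zero_le_power2[of "norm z"] by linarith+
    ultimately have "(f m)\<^sup>2 \<le> (f m)\<^sup>2 - \<delta>"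
      by (metis power_mono real_sqrt_pow2)
    then show False using \<open>\<delta> > 0\<close> by simp
  qed
  have "g m = m" if g: "g \<in> G" for g
  proof (rule unique)
    show "g m \<in> K" using invariant g m(1) .
    show "f (g m) \<le> f m"
      using f_ge[OF comp[OF _ g]] by (intro f_le)
  qed
  then show ?thesis using m(1) by blast
qed

section \<open>Matrices\<close>

lemma singular_matrix_kernel:
  fixes A :: "'a::field^'n^'n"
  assumes "det A = 0"
  shows "\<exists>v. v \<noteq> 0 \<and> A *v v = 0"
  using assms invertible_det_nz[of A] matrix_left_invertible_ker[of A]
  by (auto simp: invertible_left_inverse)

lemma singular_matrix_eigenvector:
  fixes A :: "'a::field^'n^'n"
  assumes "det (A - mat x) = 0"
  shows "\<exists>v. v \<noteq> 0 \<and> A *v v = x *s v"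
proof -
  obtain v where v: "v \<noteq> 0" "(A - mat x) *v v = 0"
    using singular_matrix_kernel[OF assms] by blast
  have "mat x *v v = x *s v"
    by (simp add: vec_eq_iff matrix_vector_mult_def mat_def if_distrib if_distribR cong: if_cong)
  then show ?thesis using v by (auto simp: matrix_vector_mult_diff_rdistrib)
qed

text \<open>Split the characteristic polynomial into linear factors and compare the quadratic
  coefficients.\<close>

lemma trace_eq_sum_eigenvalues_3:
  fixes A :: "complex^3^3"
  shows "\<exists>a b c. trace A = a + b + c \<and> (\<forall>x\<in>{a, b, c}. det (A - mat x) = 0)"
proof -
  \<comment> \<open>\<open>s\<close> is the sum of the principal 2x2 minors, which makes
    \<open>p\<close> the monic characteristic polynomial.\<close>
  define s where "s = A$1$1 * A$2$2 - A$1$2 * A$2$1 + A$1$1 * A$3$3 - A$1$3 * A$3$1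
    + A$2$2 * A$3$3 - A$2$3 * A$3$2"
  define p where "p = [:- det A, s, - trace A, 1:]"
  have charpoly: "det (A - mat x) = - poly p x" for x
    by (simp add: p_def s_def det_3 trace_def sum_3 mat_def algebra_simps power2_eq_square power3_eq_cube)
  have "p \<noteq> 0" "degree p = 3" "lead_coeff p = 1" by (auto simp: p_def)
  obtain M where M: "size M = 3" "p = (\<Prod>x\<in>#M. [:- x, 1:])"
    using alg_closed_imp_factorization[OF \<open>p \<noteq> 0\<close>] \<open>degree p = 3\<close> \<open>lead_coeff p = 1\<close> by auto
  obtain a b c where abc: "M = {#a, b, c#}"
    using M(1) by (metis numeral_3_eq_3 size_eq_Suc_imp_eq_union size_add_mset size_eq_0_iff_empty nat.inject)
  have p: "poly p x = (x - a) * (x - b) * (x - c)" for x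
    unfolding M(2) abc by (simp add: algebra_simps)
  then have "poly p x = poly [:- (a * b * c), a * b + a * c + b * c, - (a + b + c), 1:] x" for x
    unfolding p by (simp add: algebra_simps)
  then have "p = [:- (a * b * c), a * b + a * c + b * c, - (a + b + c), 1:]"
    by (metis poly_eq_poly_eq_iff ext)
  then have "trace A = a + b + c"
    unfolding p_def by (metis neg_equal_iff_equal pCons_eq_iff)
  moreover have "\<forall>x\<in>{a, b, c}. poly p x = 0"
    by (auto simp: p)
  ultimately show ?thesis unfolding charpoly by force
qed

text \<open>Writing \<open>A *v y = f y *s x\<close> with a linear functional \<open>f\<close>, both
  the trace and the factor at \<open>x\<close> equal \<open>f x\<close>.\<close>

lemma rank_one_eigenvector:
  fixes A :: "'a::field^'n^'n"
  assumes "\<And>y. \<exists>c. A *v y = c *s x"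
  shows "A *v x = trace A *s x"
proof -
  obtain f where f: "\<And>y. A *v y = f y *s x" using assms by metis
  have A: "A $ i $ j = f (axis j 1) * x $ i" for i j
    using f[of "axis j 1"] by (simp add: vec_eq_iff matrix_vector_mult_def axis_def if_distrib cong: if_cong)
  show ?thesis
    by (simp add: vec_eq_iff matrix_vector_mult_def trace_def A sum_distrib_left sum_distrib_right
        mult.commute mult.left_commute)
qed

lemma bounded_bilinear_matrix_mult:
  "bounded_bilinear ((**) :: complex^3^3 \<Rightarrow> complex^3^3 \<Rightarrow> complex^3^3)"
  unfolding bilinear_conv_bounded_bilinear[symmetric] bilinear_def
  by (auto intro!: linearI simp: vec_eq_iff matrix_matrix_mult_def sum.distrib scaleR_sum_right algebra_simps)

section \<open>The Hermitian form\<close>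

lemma herm_diff_left: "herm (x - y) z = herm x z - herm y z"
  and herm_diff_right: "herm z (x - y) = herm z x - herm z y"
  and herm_scale_left: "herm (c *s x) z = c * herm x z"
  and herm_scale_right: "herm z (c *s x) = cnj c * herm z x"
  by (simp_all add: herm_def algebra_simps)

lemma herm_scaleR: "herm (r *\<^sub>R x) (r *\<^sub>R y) = r\<^sup>2 *\<^sub>R herm x y"
  by (simp add: herm_def algebra_simps power2_eq_square scaleR_conv_of_real[where 'a = complex])

lemma cnj_herm: "cnj (herm x y) = herm y x"
  by (simp add: herm_def)

lemma herm_nondegenerate:
  assumes "\<And>z. herm z w = 0"
  shows "w = 0"
  using assms[of "axis 1 1"] assms[of "axis 2 1"] assms[of "axis 3 1"]
  by (simp add: herm_def axis_def vec_eq_iff forall_3)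

lemma SU21_iff:
  "A \<in> carrier SU21 \<longleftrightarrow> det A = 1 \<and> (\<forall>z w. herm (A *v z) (A *v w) = herm z w)"
  by (simp add: SU21_def)

lemma herm_self_if_nth_1_eq_0:
  "v $ 1 = 0 \<Longrightarrow> herm v v = of_real ((cmod (v $ 2))\<^sup>2)"
  by (simp add: herm_def complex_norm_square del: of_real_power)

text \<open>By signature (2,1), the form is positive semidefinite on the orthogonal complement of a
  null vector, with radical the line of that vector.\<close>

lemma orthogonal_to_null_vector:
  assumes v: "v \<noteq> 0" "herm v v = 0" and y: "herm y v = 0"
  shows "Re (herm y y) \<ge> 0" and "herm y y = 0 \<Longrightarrow> \<exists>c. y = c *s v"
proof -
  \<comment> \<open>Subtracting \<open>c *s v\<close> leaves \<open>herm y y\<close> unchanged. With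
    \<open>c\<close> chosen so that the first coordinate vanishes, the form sees only the second
    one, and when that is zero the whole difference is.\<close>
  obtain c where c: "(y - c *s v) $ 1 = 0" "y - c *s v = 0 \<or> (y - c *s v) $ 2 \<noteq> 0"
  proof (cases "v $ 1 = 0")
    case True
    then have "v $ 2 = 0" using v(2) by (simp add: herm_self_if_nth_1_eq_0)
    then have "v $ 3 \<noteq> 0" using v(1) True by (metis exhaust_3 vec_eq_iff zero_index)
    then have "y $ 1 = 0" using y True \<open>v $ 2 = 0\<close> by (simp add: herm_def)
    show thesis
      by (rule that[of "y $ 3 / v $ 3"])
         (use True \<open>v $ 2 = 0\<close> \<open>v $ 3 \<noteq> 0\<close> \<open>y $ 1 = 0\<close> in \<open>auto simp: vec_eq_iff forall_3\<close>)
  next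
    case False
    define z where "z = y - (y $ 1 / v $ 1) *s v"
    have "z $ 1 = 0" using False by (simp add: z_def)
    have "herm z v = 0" using v y by (simp add: z_def herm_diff_left herm_scale_left)
    then have "z = 0 \<or> z $ 2 \<noteq> 0"
      using \<open>z $ 1 = 0\<close> False by (auto simp: herm_def vec_eq_iff forall_3)
    then show thesis using that[of "y $ 1 / v $ 1"] \<open>z $ 1 = 0\<close> by (simp add: z_def)
  qed
  have "herm v y = 0" using y cnj_herm[of y v] by simp
  then have "herm y y = herm (y - c *s v) (y - c *s v)"
    using v y by (simp add: herm_diff_left herm_diff_right herm_scale_left herm_scale_right)
  then have *: "herm y y = of_real ((cmod ((y - c *s v) $ 2))\<^sup>2)"
    using herm_self_if_nth_1_eq_0[OF c(1)] by simp
  show "Re (herm y y) \<ge> 0" unfolding * by simp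
  show "\<exists>c. y = c *s v" if "herm y y = 0"
    using that c(2) unfolding * by auto
qed

section \<open>Loxodromic elements and traces\<close>

lemma SU21_surj: "A \<in> carrier SU21 \<Longrightarrow> \<exists>x. A *v x = y"
  by (metis SU21_iff invertible_def invertible_det_nz matrix_vector_mul_assoc
      matrix_vector_mul_lid zero_neq_one)

text \<open>The adjoint of \<open>A\<close> for the form is its inverse, so a left eigenvector for
  \<open>x\<close>, turned into a vector through the form, is an eigenvector of \<open>A\<close> for
  \<open>1 / cnj x\<close>.\<close>

lemma SU21_inverse_cnj_eigenvector:
  assumes A: "A \<in> carrier SU21" and "det (A - mat x) = 0" "x \<noteq> 0"
  shows "\<exists>w. w \<noteq> 0 \<and> A *v w = (1 / cnj x) *s w"
proof -
  have "transpose (A - mat x) = transpose A - mat x"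
    by (simp add: vec_eq_iff transpose_def mat_def)
  then have "det (transpose A - mat x) = 0"
    using assms(2) by (metis det_transpose)
  then obtain f where f: "f \<noteq> 0" "transpose A *v f = x *s f"
    using singular_matrix_eigenvector by blast
  \<comment> \<open>\<open>\<langle>z, w\<rangle>\<close> is the bilinear pairing of \<open>z\<close> with the left eigenvector \<open>f\<close>\<close>
  define w where "w = (vector [cnj (f $ 3), cnj (f $ 2), cnj (f $ 1)] :: complex^3)"
  have w: "w $ 1 = cnj (f $ 3)" "w $ 2 = cnj (f $ 2)" "w $ 3 = cnj (f $ 1)"
    by (simp_all add: w_def)
  have "w \<noteq> 0" using f(1) w by (auto simp: vec_eq_iff forall_3)
  have f': "A$1$i * f$1 + A$2$i * f$2 + A$3$i * f$3 = x * f$i" for i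
    using f(2) by (simp add: vec_eq_iff matrix_vector_mult_def transpose_def sum_3)
  have adj: "herm (A *v z) w = x * herm z w" for z
  proof -
    have "herm (A *v z) w = (\<Sum>i\<in>UNIV. z$i * (A$1$i * f$1 + A$2$i * f$2 + A$3$i * f$3))"
      by (simp add: herm_def w matrix_vector_mult_def sum_3 algebra_simps)
    then show ?thesis
      unfolding f' by (simp add: herm_def w sum_3 algebra_simps)
  qed
  have "A *v w - (1 / cnj x) *s w = 0"
  proof (rule herm_nondegenerate)
    fix y
    obtain z where y: "y = A *v z" using SU21_surj[OF A] by metis
    have "herm (A *v z) (A *v w) = herm z w" using A by (simp add: SU21_iff)
    then show "herm y (A *v w - (1 / cnj x) *s w) = 0"
      using adj[of z] \<open>x \<noteq> 0\<close> by (simp add: y herm_diff_right herm_scale_right)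
  qed
  then show ?thesis using \<open>w \<noteq> 0\<close> by auto
qed

text \<open>Invariance of the form multiplies \<open>herm v w\<close> by \<open>x * cnj y\<close>.
  Taking \<open>w = v\<close> shows that eigenvectors for eigenvalues off the unit circle are
  null.\<close>

lemma SU21_eigenvectors:
  assumes "A \<in> carrier SU21" "A *v v = x *s v" "A *v w = y *s w" "x * cnj y \<noteq> 1"
  shows "herm v w = 0"
proof -
  have "herm v w = x * cnj y * herm v w"
    using assms by (metis SU21_iff herm_scale_left herm_scale_right mult.assoc mult.left_commute)
  then show ?thesis using assms(4) by simp
qed

lemma span_singleton_scale:
  fixes v :: "'a::field^'n"
  assumes "c \<noteq> 0"
  shows "vec.span {c *s v} = vec.span {v}"
proof
  have "v = (1 / c) *s (c *s v)" using assms by simp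
  then have "v \<in> vec.span {c *s v}" by (metis vec.span_base vec.span_scale singletonI)
  then show "vec.span {v} \<subseteq> vec.span {c *s v}" by (simp add: vec.span_minimal)
  have "c *s v \<in> vec.span {v}" by (simp add: vec.span_base vec.span_scale)
  then show "vec.span {c *s v} \<subseteq> vec.span {v}" by (simp add: vec.span_minimal)
qed

lemma span_singleton_invariant_iff:
  fixes A :: "complex^3^3"
  assumes "A \<in> carrier SU21" "v \<noteq> 0"
  shows "proj_act A (vec.span {v}) = vec.span {v} \<longleftrightarrow> (\<exists>c. A *v v = c *s v)"
proof
  assume "proj_act A (vec.span {v}) = vec.span {v}"
  then show "\<exists>c. A *v v = c *s v"
    unfolding proj_act_span using vec.span_base[of "A *v v" "{A *v v}"]
    by (auto simp: vec.span_singleton)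
next
  assume "\<exists>c. A *v v = c *s v"
  then obtain c where c: "A *v v = c *s v" by blast
  have "c \<noteq> 0"
    using assms c invertible_det_nz[of A] matrix_left_invertible_ker[of A]
    by (auto simp: SU21_iff invertible_left_inverse)
  then show "proj_act A (vec.span {v}) = vec.span {v}"
    unfolding proj_act_span c by (rule span_singleton_scale)
qed

lemma loxodromic_if_trace_gt_3:
  assumes A: "A \<in> carrier SU21" and tr: "cmod (trace A) > 3"
  shows "loxodromic A"
proof -
  obtain a b c where abc: "trace A = a + b + c" "\<forall>x\<in>{a, b, c}. det (A - mat x) = 0"
    using trace_eq_sum_eigenvalues_3 by blast
  have "cmod (trace A) \<le> cmod a + cmod b + cmod c"
    unfolding abc(1) by (metis norm_triangle_le norm_triangle_ineq add_mono order_refl)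
  then have "cmod a > 1 \<or> cmod b > 1 \<or> cmod c > 1"
    using tr by linarith
  then obtain x where x: "cmod x > 1" "det (A - mat x) = 0"
    using abc(2) by auto
  have "x \<noteq> 0" using x(1) by auto
  \<comment> \<open>The eigenvalue paired with \<open>x\<close>: same argument, reciprocal
    modulus.\<close>
  define y where "y = 1 / cnj x"
  have y: "cmod y < 1" "x * cnj y = 1" "y * cnj x = 1"
    using x(1) \<open>x \<noteq> 0\<close> by (auto simp: y_def norm_divide)
  have "cmod (x * cnj x) > 1" "cmod (y * cnj y) < 1"
    using x(1) y(1) unfolding complex_mod_mult_cnj
    by (auto intro!: one_less_power power_less_one_iff[THEN iffD2])
  then have norm_xx: "x * cnj x \<noteq> 1" "y * cnj y \<noteq> 1"
    by auto
  obtain v where v: "v \<noteq> 0" "A *v v = x *s v"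
    using singular_matrix_eigenvector[OF x(2)] by blast
  obtain w where w: "w \<noteq> 0" "A *v w = y *s w"
    using SU21_inverse_cnj_eigenvector[OF A x(2) \<open>x \<noteq> 0\<close>] by (auto simp: y_def)
  have null: "herm v v = 0" "herm w w = 0"
    using SU21_eigenvectors[OF A] v w norm_xx by blast+
  \<comment> \<open>An eigenvector orthogonal to neither would have an eigenvalue inverse to both
    \<open>cnj x\<close> and \<open>cnj y\<close>. By \<open>orthogonal_to_null_vector\<close>,
    eigenvectors are therefore never negative, and null ones are multiples of \<open>v\<close> or
    \<open>w\<close>.\<close>
  have eig: "herm z v = 0 \<or> herm z w = 0" if "A *v z = t *s z" for z t
  proof (rule ccontr)
    assume "\<not> ?thesis"
    then have "t * cnj x = 1" "t * cnj y = 1"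
      using SU21_eigenvectors[OF A that] v(2) w(2) by blast+
    then have "x = y" using \<open>x \<noteq> 0\<close>
      by (metis complex_cnj_cancel_iff mult_cancel_left mult_zero_left zero_neq_one)
    then show False using x(1) y(1) by simp
  qed
  have "proj_act A p \<noteq> p" if "p \<in> HC2" for p
  proof
    assume fix_p: "proj_act A p = p"
    obtain z where z: "p = vec.span {z}" "Re (herm z z) < 0"
      using \<open>p \<in> HC2\<close> by (auto simp: HC2_def)
    have "z \<noteq> 0" using z(2) by (auto simp: herm_def)
    obtain t where "A *v z = t *s z"
      using fix_p span_singleton_invariant_iff[OF A \<open>z \<noteq> 0\<close>] z(1) by auto
    then show False
      using eig orthogonal_to_null_vector(1) v(1) w(1) null z(2) by (metis not_less)
  qed
  moreover have "{p \<in> boundary_HC2. proj_act A p = p} = {vec.span {v}, vec.span {w}}"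
  proof (intro equalityI subsetI)
    fix p assume "p \<in> {p \<in> boundary_HC2. proj_act A p = p}"
    then have p: "p \<in> boundary_HC2" "proj_act A p = p" by auto
    obtain z where z: "p = vec.span {z}" "z \<noteq> 0" "herm z z = 0"
      using p(1) by (auto simp: boundary_HC2_def)
    obtain t where "A *v z = t *s z"
      using p(2) span_singleton_invariant_iff[OF A z(2)] z(1) by auto
    then obtain c u where u: "z = c *s u" "u = v \<or> u = w"
      using eig orthogonal_to_null_vector(2) v(1) w(1) null z(3) by metis
    have "c \<noteq> 0" using u(1) z(2) by auto
    then have "p = vec.span {u}"
      unfolding z(1) u(1) by (rule span_singleton_scale)
    then show "p \<in> {vec.span {v}, vec.span {w}}" using u(2) by auto
  qed (use v w null span_singleton_invariant_iff[OF A] in \<open>auto simp: boundary_HC2_def\<close>)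
  moreover have "vec.span {v} \<noteq> vec.span {w}"
  proof
    assume "vec.span {v} = vec.span {w}"
    then have "v \<in> vec.span {w}" using vec.span_base by blast
    then obtain c where c: "v = c *s w" by (auto simp: vec.span_singleton)
    then have "x *s v = y *s v"
      using v(2) w(2) by (auto simp: vector_scalar_commute mult.commute)
    then have "x = y" using v(1) by simp
    then show False using x(1) y(1) by simp
  qed
  ultimately show ?thesis
    using A unfolding loxodromic_def by simp
qed

section \<open>Bounded traces and bounded groups\<close>

lemma irreducible_bounded_if_traces_bounded:
  assumes \<Gamma>: "\<Gamma> \<subseteq> carrier SU21" "mat 1 \<in> \<Gamma>" "\<And>A B. A \<in> \<Gamma> \<Longrightarrow> B \<in> \<Gamma> \<Longrightarrow> A ** B \<in> \<Gamma>"
    and irred: "irreducible_on_V \<Gamma>"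
    and tr: "\<And>A. A \<in> \<Gamma> \<Longrightarrow> cmod (trace A) \<le> C"
  shows "\<exists>B. \<forall>A\<in>\<Gamma>. norm A \<le> B"
proof (rule ccontr)
  assume "\<not> ?thesis"
  then have "\<forall>n::nat. \<exists>A\<in>\<Gamma>. real n < norm A"
    by (meson not_le)
  then obtain A where A: "\<And>n. A n \<in> \<Gamma>" "\<And>n. real n < norm (A n)"
    by metis
  have "A n \<noteq> 0" for n
    using A(2)[of n] by auto
  then have "\<forall>n. A n /\<^sub>R norm (A n) \<in> sphere 0 1"
    by simp
  then obtain T r where T: "T \<in> sphere 0 1" and r: "strict_mono r"
    and "((\<lambda>n. A n /\<^sub>R norm (A n)) \<circ> r) \<longlonglongrightarrow> T"
    using compact_sphere[of 0 1] unfolding compact_def by meson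
  define k where "k n = inverse (norm (A (r n)))" for n
  have lim_T: "(\<lambda>n. k n *\<^sub>R A (r n)) \<longlonglongrightarrow> T"
    using \<open>_ \<longlonglongrightarrow> T\<close> by (simp add: o_def k_def)
  have "filterlim (\<lambda>n. norm (A (r n))) at_top sequentially"
  proof (rule filterlim_at_top_mono[OF filterlim_real_sequentially], rule always_eventually, rule allI)
    fix n
    show "real n \<le> norm (A (r n))"
      using A(2)[of "r n"] seq_suble[OF r, of n] by linarith
  qed
  then have k: "k \<longlonglongrightarrow> 0"
    unfolding k_def by (rule tendsto_inverse_0_at_top)
  \<comment> \<open>Each \<open>A (r n)\<close> preserves the form, so the normalized matrix scales
    it by \<open>(k n)\<^sup>2\<close>, which tends to 0.\<close>
  have isotropic: "herm (T *v v) (T *v w) = 0" for v w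
  proof -
    have "(\<lambda>n. herm ((k n *\<^sub>R A (r n)) *v v) ((k n *\<^sub>R A (r n)) *v w)) \<longlonglongrightarrow> herm (T *v v) (T *v w)"
      unfolding herm_def matrix_vector_mult_def vec_lambda_beta
      by (intro tendsto_intros lim_T)
    moreover have "herm ((k n *\<^sub>R A (r n)) *v v) ((k n *\<^sub>R A (r n)) *v w) = (k n)\<^sup>2 *\<^sub>R herm v w" for n
    proof -
      have "(k n *\<^sub>R A (r n)) *v u = k n *\<^sub>R (A (r n) *v u)" for u
        by (simp add: vec_eq_iff matrix_vector_mult_def scaleR_sum_right)
      moreover have "herm (A (r n) *v v) (A (r n) *v w) = herm v w"
        using subsetD[OF \<Gamma>(1) A(1)] by (simp add: SU21_iff)
      ultimately show ?thesis by (simp add: herm_scaleR)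
    qed
    moreover have "(\<lambda>n. (k n)\<^sup>2 *\<^sub>R herm v w) \<longlonglongrightarrow> 0\<^sup>2 *\<^sub>R herm v w"
      by (intro tendsto_intros k)
    ultimately show ?thesis by (simp add: LIMSEQ_unique)
  qed
  \<comment> \<open>The products \<open>A (r n) ** B\<close> stay in \<open>\<Gamma>\<close>, so
    their traces are bounded by \<open>C\<close> and the factor \<open>k n\<close> sends them to
    0.\<close>
  have trace_0: "trace (T ** B) = 0" if "B \<in> \<Gamma>" for B
  proof -
    have "(\<lambda>n. trace ((k n *\<^sub>R A (r n)) ** B)) \<longlonglongrightarrow> trace (T ** B)"
      unfolding trace_def matrix_matrix_mult_def vec_lambda_beta
      by (intro tendsto_intros lim_T)
    moreover have "(\<lambda>n. trace ((k n *\<^sub>R A (r n)) ** B)) \<longlonglongrightarrow> 0"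
    proof (rule Lim_null_comparison)
      have "norm (trace ((k n *\<^sub>R A (r n)) ** B)) \<le> k n * C" for n
      proof -
        have "trace ((k n *\<^sub>R A (r n)) ** B) = k n *\<^sub>R trace (A (r n) ** B)"
          by (simp add: trace_def matrix_matrix_mult_def scaleR_sum_right)
        moreover have "k n \<ge> 0" by (simp add: k_def)
        ultimately show ?thesis
          using tr[OF \<Gamma>(3)[OF A(1)[of "r n"] that]] by (simp add: mult_left_mono)
      qed
      then show "\<forall>\<^sub>F n in sequentially. norm (trace ((k n *\<^sub>R A (r n)) ** B)) \<le> k n * C" by simp
      show "(\<lambda>n. k n * C) \<longlonglongrightarrow> 0"
        using tendsto_mult[OF k tendsto_const[of C]] by simp
    qed
    ultimately show ?thesis by (rule LIMSEQ_unique)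
  qed
  have "T \<noteq> 0" using T by auto
  then obtain v where v: "T *v v \<noteq> 0" by (metis matrix_eq matrix_vector_mult_0)
  \<comment> \<open>The largest \<open>\<Gamma>\<close>-invariant subspace inside the kernel of
    \<open>T\<close>; it will contain \<open>T *v v\<close> but not \<open>v\<close>.\<close>
  define W where "W = {w. \<forall>B\<in>\<Gamma>. T *v (B *v w) = 0}"
  have "T *v (B *v (T *v v)) = 0" if B: "B \<in> \<Gamma>" for B
  proof -
    \<comment> \<open>Any vector in the image of \<open>T\<close> is null and orthogonal to the null
      vector \<open>T *v v\<close>, hence a multiple of it.\<close>
    have "\<exists>c. (T ** B) *v y = c *s (T *v v)" for y
      using orthogonal_to_null_vector(2)[OF v isotropic isotropic isotropic, of "B *v y"]
      by (simp add: matrix_vector_mul_assoc)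
    then have "(T ** B) *v (T *v v) = trace (T ** B) *s (T *v v)"
      by (rule rank_one_eigenvector)
    then show ?thesis
      by (simp add: trace_0[OF B] matrix_vector_mul_assoc matrix_mul_assoc)
  qed
  then have "W \<noteq> {0}" using v by (auto simp: W_def)
  moreover have "v \<notin> W" using v \<Gamma>(2) by (force simp: W_def)
  moreover have "vec.subspace W"
    by (auto simp: W_def vec.subspace_def matrix_vector_right_distrib vector_scalar_commute)
  moreover have "\<forall>A\<in>\<Gamma>. \<forall>w\<in>W. A *v w \<in> W"
    using \<Gamma>(3) by (auto simp: W_def matrix_vector_mul_assoc simp flip: matrix_mul_assoc)
  ultimately show False
    using irred unfolding reducible_on_V_def by blast
qed

text \<open>Schur's lemma: an eigenspace of \<open>Y\<close> is invariant under
  \<open>\<Gamma>\<close> and nonzero, hence everything.\<close>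

lemma irreducible_commuting_matrix_scalar:
  fixes Y :: "complex^3^3"
  assumes comm: "\<And>A. A \<in> \<Gamma> \<Longrightarrow> A ** Y = Y ** A" and irred: "irreducible_on_V \<Gamma>"
  shows "\<exists>c. \<forall>v. Y *v v = c *s v"
proof -
  obtain c v where v: "v \<noteq> 0" "Y *v v = c *s v"
    using trace_eq_sum_eigenvalues_3[of Y] singular_matrix_eigenvector by blast
  define W where "W = {v. Y *v v = c *s v}"
  have "vec.subspace W"
    by (auto simp: W_def vec.subspace_def matrix_vector_right_distrib vector_scalar_commute
        vector_add_ldistrib mult.commute)
  moreover have "A *v w \<in> W" if "A \<in> \<Gamma>" "w \<in> W" for A w
  proof -
    have "Y *v (A *v w) = A *v (Y *v w)"
      by (simp add: matrix_vector_mul_assoc comm[OF that(1)])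
    then show ?thesis using that(2) by (simp add: W_def vector_scalar_commute)
  qed
  moreover have "v \<in> W" using v by (simp add: W_def)
  ultimately have "W = UNIV"
    using irred v(1) unfolding reducible_on_V_def by blast
  then show ?thesis by (auto simp: W_def)
qed

lemma bounded_subgroup_reducible:
  assumes \<Gamma>: "subgroup \<Gamma> SU21" and bound: "\<And>A. A \<in> \<Gamma> \<Longrightarrow> norm A \<le> B"
  shows "reducible_on_V \<Gamma>"
proof (rule ccontr)
  assume irred: "\<not> reducible_on_V \<Gamma>"
  interpret group SU21 by (rule group_SU21)
  have one: "mat 1 \<in> \<Gamma>" using subgroup.one_closed[OF \<Gamma>] by (simp add: SU21_def)
  have mult: "P ** Q \<in> \<Gamma>" if "P \<in> \<Gamma>" "Q \<in> \<Gamma>" for P Q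
    using subgroup.m_closed[OF \<Gamma> that] by (simp add: SU21_def)
  have inv: "\<exists>Q\<in>\<Gamma>. P ** Q = mat 1" if "P \<in> \<Gamma>" for P
    using subgroup.m_inv_closed[OF \<Gamma> that] r_inv[OF subgroup.mem_carrier[OF \<Gamma> that]]
    by (auto simp: SU21_def)
  have herm_\<Gamma>: "herm (P *v z) (P *v w) = herm z w" if "P \<in> \<Gamma>" for P z w
    using subgroup.mem_carrier[OF \<Gamma> that] by (simp add: SU21_iff)
  note bb = bounded_bilinear_matrix_mult
  obtain D where D: "D > 0" "\<And>(P :: complex^3^3) (Q :: complex^3^3). norm (P ** Q) \<le> norm P * norm Q * D"
    using bounded_bilinear.pos_bounded[OF bb] by blast
  \<comment> \<open>Conjugations by elements of \<open>\<Gamma>\<close>, with \<open>Q\<close> as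
    the inverse of \<open>P\<close>.\<close>
  define G where "G = {(\<lambda>Y. P ** Y ** Q) | P Q. P \<in> \<Gamma> \<and> Q \<in> \<Gamma> \<and> P ** Q = mat 1}"
  have G_I: "(\<lambda>Y. P ** Y ** Q) \<in> G" if "P \<in> \<Gamma>" "Q \<in> \<Gamma>" "P ** Q = mat 1" for P Q
    using that unfolding G_def by auto
  \<comment> \<open>The trace condition excludes \<open>Y = 0\<close> and positive scalars; it can
    be met because the form has a negative direction.\<close>
  define K where "K = {Y :: complex^3^3. trace Y = -1 \<and> (\<forall>v. 0 \<le> Re (herm (Y *v v) v))}"
  have "\<exists>Y\<in>K. \<forall>g\<in>G. g Y = Y"
  proof (rule bounded_linear_group_fixed_point)
    fix g assume "g \<in> G"
    then obtain P Q where g: "g = (\<lambda>Y. P ** Y ** Q)" and PQ: "P \<in> \<Gamma>" "Q \<in> \<Gamma>" "P ** Q = mat 1"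
      by (auto simp: G_def)
    have QP: "Q ** P = mat 1" using PQ(3) by (simp add: matrix_left_right_inverse)
    show "linear g"
      unfolding g by (intro linearI) 
        (simp_all add: bounded_bilinear.add_left[OF bb] bounded_bilinear.add_right[OF bb]
          bounded_bilinear.scaleR_left[OF bb] bounded_bilinear.scaleR_right[OF bb])
    have "Q ** (P ** Y ** Q) ** P = Y" for Y
      by (metis QP matrix_mul_assoc matrix_mul_lid matrix_mul_rid)
    then show "\<exists>h\<in>G. \<forall>x. h (g x) = x"
      unfolding g using G_I[OF PQ(2,1) QP] by (intro bexI[of _ "\<lambda>Y. Q ** Y ** P"]) auto
    have norm_P: "norm P \<le> B" and norm_Q: "norm Q \<le> B" using bound PQ by auto
    \<comment> \<open>Each of the two products costs one factor \<open>B\<close> for the group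
      element and one factor \<open>D\<close> for the matrix product.\<close>
    show "norm (g Y) \<le> (B * B * D * D) * norm Y" for Y
    proof -
      have "norm (P ** Y) \<le> B * norm Y * D"
        using D norm_P by (meson mult_right_mono norm_ge_zero order_trans less_imp_le)
      moreover have "B \<ge> 0" using norm_P norm_ge_zero order_trans by blast
      ultimately have "norm (P ** Y) * norm Q * D \<le> (B * norm Y * D) * B * D"
        using D norm_Q by (intro mult_mono mult_nonneg_nonneg) auto
      then show ?thesis
        using D(2)[of "P ** Y" Q] by (simp add: g mult_ac)
    qed
    show "g Y \<in> K" if Y: "Y \<in> K" for Y
    proof -
      have "trace (g Y) = trace Y"
        unfolding g by (metis QP matrix_mul_assoc matrix_mul_lid trace_mul_sym)
      \<comment> \<open>Since \<open>v = P *v (Q *v v)\<close>, invariance under \<open>P\<close>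
        moves positivity at \<open>v\<close> to positivity at \<open>Q *v v\<close>.\<close>
      moreover have "herm (g Y *v v) v = herm (Y *v (Q *v v)) (Q *v v)" for v
      proof -
        have "herm (g Y *v v) v = herm (P *v (Y *v (Q *v v))) (P *v (Q *v v))"
          by (simp add: g matrix_vector_mul_assoc matrix_mul_assoc PQ(3))
        then show ?thesis by (simp add: herm_\<Gamma>[OF PQ(1)])
      qed
      ultimately show ?thesis using Y by (simp add: K_def)
    qed
    show "(\<lambda>Y. g (h Y)) \<in> G" if "h \<in> G" for h
    proof -
      obtain P' Q' where h: "h = (\<lambda>Y. P' ** Y ** Q')" and PQ': "P' \<in> \<Gamma>" "Q' \<in> \<Gamma>" "P' ** Q' = mat 1"
        using \<open>h \<in> G\<close> by (auto simp: G_def)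
      have "(P ** P') ** (Q' ** Q) = mat 1"
        by (metis PQ(3) PQ'(3) matrix_mul_assoc matrix_mul_rid)
      then show ?thesis
        using G_I[OF mult[OF PQ(1) PQ'(1)] mult[OF PQ'(2) PQ(2)]] unfolding g h
        by (simp add: matrix_mul_assoc)
    qed
  next
    show "(\<lambda>Y. Y) \<in> G" using G_I[OF one one] by simp
    have "closed {Y :: complex^3^3. 0 \<le> Re (herm (Y *v v) v)}" for v
      unfolding herm_def matrix_vector_mult_def vec_lambda_beta
      by (intro closed_Collect_le continuous_intros)
    moreover have "closed {Y :: complex^3^3. trace Y = -1}"
      unfolding trace_def by (intro closed_Collect_eq continuous_intros)
    ultimately show "closed K"
      unfolding K_def by (intro closed_Collect_conj closed_Collect_all)
    show "convex K"
    proof (rule convexI)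
      fix X Y :: "complex^3^3" and s t :: real
      assume *: "X \<in> K" "Y \<in> K" "0 \<le> s" "0 \<le> t" "s + t = 1"
      have "trace (s *\<^sub>R X + t *\<^sub>R Y) = s *\<^sub>R trace X + t *\<^sub>R trace Y"
        by (simp add: trace_def sum.distrib scaleR_sum_right)
      also have "\<dots> = (s + t) *\<^sub>R (-1)"
        using *(1,2) unfolding K_def scaleR_add_left by simp
      finally have "trace (s *\<^sub>R X + t *\<^sub>R Y) = -1" using * by simp
      moreover have "herm ((s *\<^sub>R X + t *\<^sub>R Y) *v v) v
          = s *\<^sub>R herm (X *v v) v + t *\<^sub>R herm (Y *v v) v" for v
        by (simp add: herm_def matrix_vector_mult_def sum_3 algebra_simps)
      ultimately show "s *\<^sub>R X + t *\<^sub>R Y \<in> K"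
        using * by (simp add: K_def)
    qed
    \<comment> \<open>\<open>Y = \<langle>\<cdot>, v\<rangle> v\<close> for \<open>v = (1, 0, -1/2)\<close>, which has \<open>\<langle>v, v\<rangle> = -1\<close>\<close>
    define v where "v = (vector [1, 0, -1/2] :: complex^3)"
    define Y where "Y = (vector [vector [-1/2, 0, 1], 0, vector [1/4, 0, -1/2]] :: complex^3^3)"
    have "Y *v z = herm z v *s v" for z
      by (simp add: Y_def v_def herm_def matrix_vector_mult_def vec_eq_iff sum_3 forall_3 field_simps)
    then have "herm (Y *v z) z = herm z v * cnj (herm z v)" for z
      by (simp add: herm_scale_left cnj_herm)
    then have "Re (herm (Y *v z) z) \<ge> 0" for z
      by simp
    moreover have "trace Y = -1" by (simp add: trace_def Y_def sum_3)
    ultimately have "Y \<in> K" by (simp add: K_def)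
    then show "K \<noteq> {}" by blast
  qed
  then obtain Y where Y: "Y \<in> K" "\<And>g. g \<in> G \<Longrightarrow> g Y = Y" by blast
  have "P ** Y = Y ** P" if P: "P \<in> \<Gamma>" for P
  proof -
    obtain Q where Q: "Q \<in> \<Gamma>" "P ** Q = mat 1" using inv[OF P] by blast
    then have "P ** Y ** Q = Y" using Y(2)[OF G_I[OF P]] by simp
    moreover have "Q ** P = mat 1" using Q(2) by (simp add: matrix_left_right_inverse)
    ultimately show ?thesis by (metis matrix_mul_assoc matrix_mul_rid)
  qed
  then obtain c where c: "\<And>v. Y *v v = c *s v"
    using irreducible_commuting_matrix_scalar irred by meson
  have "Y $ i $ i = c" for i
    using c[of "axis i 1"]
    by (simp add: vec_eq_iff matrix_vector_mult_def axis_def if_distrib cong: if_cong)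
  then have "3 * c = -1" using Y(1) by (simp add: K_def trace_def)
  \<comment> \<open>The second basis vector is positive, with \<open>herm\<close> value 1, so the
    condition in \<open>K\<close> reads \<open>0 \<le> Re c\<close> there.\<close>
  moreover have "Re c \<ge> 0"
    using Y(1) c[of "axis 2 1"] by (auto simp: K_def herm_def axis_def dest!: spec[of _ "axis 2 1"])
  ultimately show False by (auto dest: arg_cong[where f = Re])
qed

theorem proposition2p3:
  fixes \<Gamma> :: "(complex^3^3) set"
  assumes "subgroup \<Gamma> SU21"
    and "irreducible_on_V \<Gamma>"
  shows "\<exists>A\<in>\<Gamma>. loxodromic A"
proof (rule ccontr)
  assume "\<not> ?thesis"
  then have tr: "cmod (trace A) \<le> 3" if "A \<in> \<Gamma>" for A
    using loxodromic_if_trace_gt_3 subgroup.mem_carrier[OF assms(1)] that by (meson not_le)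
  have "mat 1 \<in> \<Gamma>" "\<And>A B. A \<in> \<Gamma> \<Longrightarrow> B \<in> \<Gamma> \<Longrightarrow> A ** B \<in> \<Gamma>"
    using subgroup.one_closed[OF assms(1)] subgroup.m_closed[OF assms(1)] by (auto simp: SU21_def)
  then obtain B where "\<forall>A\<in>\<Gamma>. norm A \<le> B"
    using irreducible_bounded_if_traces_bounded[OF subgroup.subset[OF assms(1)] _ _ assms(2) tr] by blast
  then show False
    using bounded_subgroup_reducible[OF assms(1)] assms(2) by blast
qed

end
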